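(* Let $C\subseteq\mathbb{R}^2$ be the interior of a convex body such that there exist linearly independent unit vectors $u,v\in\mathbb{R}^2$ and points $p_1,p_2,p_3,p_4\in\operatorname{bd}C$ such that $\operatorname{bd}C$ is $C^2$ in a neighborhood of $p_1,p_2,p_3,p_4$, with outer normals $u,v,-u,-v$, respectively. Let $0<c<c'<1$. Then for $cn\le k\le c'n$ we have $$\max_{S\subseteq\mathbb{R}^2,\ |S|=n}a_k(S)=\Omega(n^2),$$ where $a_k(S)$ is the number of $T_C$-$k$-sets of $S$ and the constants in $\Omega$ depend only on $c$, $c'$ and $C$.
   Context: A convex body is a compact convex set with non-empty interior. $T_C=\{x+C:x\in\mathbb{R}^2\}$ is the family of translations of $C$. A $T_C$-$k$-set of a finite set $S\subseteq\mathbb{R}^2$ is a subset $T\subseteq S$ of $k$ points such that for some $Q\in T_C$ we have $S\cap\operatorname{bd}Q=\emptyset$ and $T=S\cap Q$. (The maximum is over all sets $S$ of $n$ points, with no general position requirement.) Definition: for $C$ the interior of a convex body in $\mathbb{R}^2$, $\operatorname{bd}C$ is $C^2$ at a point $x\in\operatorname{bd}C$ if (1) there is a unique support line $L$ of $C$ at $x$; and (2) after applying an invertible affine transformation so that $x$ is at the origin, $L$ is horizontal and $C$ is above $L$, the lower side of $\operatorname{bd}C$ is represented in the form $(t,g(t))$ in a neighborhood of $0$ for a convex function $g$ such that there is a function $r(t)=at^2$ with $a>0$ and $g(t)=r(t)+o(t^2)$ as $t\to0$. "$\operatorname{bd}C$ is $C^2$ in a neighborhood of $x$" means it is $C^2$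 at every point of $\operatorname{bd}C$ in some neighborhood of $x$. *)

theory Defs
  imports "HOL-Analysis.Analysis" "HOL-Library.Landau_Symbols"
begin

definition convex_body :: "(real^2) set \<Rightarrow> bool" where
  "convex_body K \<longleftrightarrow> compact K \<and> convex K \<and> interior K \<noteq> {}"

definition translates :: "(real^2) set \<Rightarrow> (real^2) set set" where
  "translates C = {(+) x ` C | x. True}"

definition is_k_set :: "(real^2) set set \<Rightarrow> nat \<Rightarrow> (real^2) set \<Rightarrow> (real^2) set \<Rightarrow> bool" where
  "is_k_set F k S T \<longleftrightarrow>
     T \<subseteq> S \<and> card T = k \<and> (\<exists>Q\<in>F. S \<inter> frontier Q = {} \<and> T = S \<inter> Q)"

definition num_k_sets :: "(real^2) set set \<Rightarrow> nat \<Rightarrow> (real^2) set \<Rightarrow> nat" where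
  "num_k_sets F k S = card {T. is_k_set F k S T}"

text \<open>For finite \<open>S\<close> the number of k-sets is at most \<open>2 ^ card S\<close>, so the following is
  the maximum of a finite nonempty set of naturals.\<close>

definition max_k_sets :: "(real^2) set set \<Rightarrow> nat \<Rightarrow> nat \<Rightarrow> nat" where
  "max_k_sets F k n = Max {num_k_sets F k S | S. finite S \<and> card S = n}"

definition outer_normal :: "(real^2) set \<Rightarrow> real^2 \<Rightarrow> real^2 \<Rightarrow> bool" where
  "outer_normal C x w \<longleftrightarrow> w \<noteq> 0 \<and> (\<forall>y\<in>C. w \<bullet> y \<le> w \<bullet> x)"

definition support_line :: "(real^2) set \<Rightarrow> real^2 \<Rightarrow> (real^2) set \<Rightarrow> bool" where
  "support_line C x L \<longleftrightarrow> (\<exists>w. outer_normal C x w \<and> L = {y. w \<bullet> y = w \<bullet> x})"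

definition invertible_affine :: "(real^2 \<Rightarrow> real^2) \<Rightarrow> bool" where
  "invertible_affine A \<longleftrightarrow>
     (\<exists>(M::real^2^2) b. invertible M \<and> A = (\<lambda>y. M *v y + b))"

text \<open>The lower side of a set \<open>B\<close> over an abscissa \<open>t\<close> is the point of \<open>B\<close> on the
  vertical line through \<open>t\<close> with the smallest ordinate.\<close>

definition lower_side_graph :: "(real^2) set \<Rightarrow> real \<Rightarrow> (real \<Rightarrow> real) \<Rightarrow> bool" where
  "lower_side_graph B e g \<longleftrightarrow>
     (\<forall>t\<in>{-e<..<e}. vector [t, g t] \<in> B \<and> (\<forall>s. vector [t, s] \<in> B \<longrightarrow> g t \<le> s))"

text \<open>Being \<open>C\<^sup>2\<close> at a point here includes \<open>a > 0\<close>, i.e. strictly positive curvature.\<close>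

definition C2_at :: "(real^2) set \<Rightarrow> real^2 \<Rightarrow> bool" where
  "C2_at C x \<longleftrightarrow> x \<in> frontier C \<and>
     (\<exists>L. support_line C x L \<and> (\<forall>L'. support_line C x L' \<longrightarrow> L' = L) \<and>
       (\<exists>A g a e.
          invertible_affine A \<and> A x = 0 \<and>
          A ` L = {y. y $ 2 = 0} \<and> A ` C \<subseteq> {y. y $ 2 \<ge> 0} \<and>
          e > 0 \<and> convex_on {-e<..<e} g \<and> lower_side_graph (frontier (A ` C)) e g \<and>
          a > 0 \<and> (\<lambda>t. g t - a * t\<^sup>2) \<in> o[at 0](\<lambda>t. t\<^sup>2)))"

definition C2_near :: "(real^2) set \<Rightarrow> real^2 \<Rightarrow> bool" where
  "C2_near C x \<longleftrightarrow> (\<exists>U. open U \<and> x \<in> U \<and> (\<forall>y\<in>U \<inter> frontier C. C2_at C y))"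

end

theory Submission
  imports Defs
begin

text \<open>
  Write a translate of \<open>C\<close> as \<open>x + C\<close>. Whether a point \<open>s\<close> lies in it depends on the
  position of \<open>s - x\<close>. Suppose that \<open>p\<close> is a boundary point with only one outer normal \<open>w\<close>
  up to scaling, and that \<open>s = p + \<delta> e\<close> and \<open>x = \<delta> y\<close> with \<open>e\<close>, \<open>y\<close> from finite sets. As
  \<open>\<delta>\<close> tends to 0, \<open>C\<close> looks like a half-plane near \<open>p\<close>, so for all small \<open>\<delta>\<close> the point
  \<open>s\<close> lies in \<open>x + C\<close> if \<open>w \<bullet> e < w \<bullet> y\<close> and outside its closure if \<open>w \<bullet> e > w \<bullet> y\<close>.

  Put a row of \<open>2 M\<close> points \<open>p\<^sub>w + \<delta> (m + 1/2) a\<^sub>w\<close>, \<open>-M \<le> m < M\<close>, at the boundary point of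
  each of the four normals \<open>w \<in> {u, v, -u, -v}\<close>, where \<open>w \<bullet> a\<^sub>w = 1\<close>. The translate by
  \<open>\<delta> y\<close>, with \<open>w \<bullet> y\<close> an integer of absolute value at most \<open>M\<close>, contains exactly the
  \<open>M + w \<bullet> y\<close> innermost points of the row of \<open>w\<close>. What is gained at \<open>w\<close> is lost at \<open>-w\<close>,
  so each translate contains \<open>4 M\<close> row points in all, and the set of these points determines
  \<open>u \<bullet> y\<close> and \<open>v \<bullet> y\<close>. Since \<open>u\<close> and \<open>v\<close> are linearly independent, these two integers can
  be prescribed freely, which gives \<open>(2 M + 1)\<^sup>2\<close> different sets. Adding \<open>k - 4 M\<close> points
  deep inside \<open>C\<close> and \<open>n - k - 4 M\<close> points far away turns them into \<open>k\<close>-sets of a set of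
  \<open>n\<close> points, and \<open>M\<close> can be a fixed fraction of \<open>n\<close> because \<open>k\<close> and \<open>n - k\<close> are both at
  least a fixed fraction of \<open>n\<close>.

  The geometric input is in \<open>smooth_point_ray_inside\<close> and \<open>outer_normal_ray_outside\<close>, the
  construction in \<open>many_k_sets_from_balanced_normals\<close>.
\<close>

section \<open>Boundary points with a unique normal direction\<close>

text \<open>For nonzero \<open>w\<close> and \<open>w'\<close> the inclusion of open half-planes in the last conjunct means that
  \<open>w'\<close> is a positive multiple of \<open>w\<close>; the inclusion is the form in which uniqueness of
  the normal is used.\<close>

definition smooth_point :: "(real^2) set \<Rightarrow> real^2 \<Rightarrow> real^2 \<Rightarrow> bool" where
  "smooth_point C p w \<longleftrightarrow> p \<in> closure C \<and> outer_normal C p w \<and>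
     (\<forall>w' d. outer_normal C p w' \<and> w \<bullet> d < 0 \<longrightarrow> w' \<bullet> d < 0)"

lemma outer_normal_open_strict:
  assumes "open C" "outer_normal C p w" "z \<in> C"
  shows "w \<bullet> z < w \<bullet> p"
proof -
  obtain e where e: "e > 0" "ball z e \<subseteq> C"
    using assms openE by blast
  have w: "w \<noteq> 0" and sup: "\<And>y. y \<in> C \<Longrightarrow> w \<bullet> y \<le> w \<bullet> p"
    using assms(2) by (auto simp: outer_normal_def)
  define y where "y = z + (e / 2 / norm w) *\<^sub>R w"
  have "dist z y < e"
    using e w by (simp add: y_def dist_norm)
  then have "w \<bullet> y \<le> w \<bullet> p"
    using e sup by auto
  moreover have "w \<bullet> y = w \<bullet> z + (e / 2 / norm w) * (w \<bullet> w)"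
    by (simp add: y_def inner_right_distrib)
  moreover have "(e / 2 / norm w) * (w \<bullet> w) > 0"
    using e w by (intro mult_pos_pos) auto
  ultimately show ?thesis by linarith
qed

text \<open>Uniqueness of the support line says only that \<open>w\<close> and another outer normal \<open>w'\<close> vanish
  on the same directions; that they also have the same sign follows because both are negative
  on directions pointing into \<open>C\<close>.\<close>

lemma C2_at_imp_smooth_point:
  assumes "open C" "C \<noteq> {}" "C2_at C p" and w: "outer_normal C p w"
  shows "smooth_point C p w"
proof -
  obtain z where z: "z \<in> C" using assms by blast
  have "w' \<bullet> d < 0" if w': "outer_normal C p w'" and d: "w \<bullet> d < 0" for w' d
  proof (rule ccontr)
    assume "\<not> w' \<bullet> d < 0"
    then have d': "w' \<bullet> d \<ge> 0" by simp
    have same: "{y. w \<bullet> y = w \<bullet> p} = {y. w' \<bullet> y = w' \<bullet> p}"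
      using assms(3) w w' unfolding C2_at_def support_line_def by metis
    define e where "e = z - p"
    have e: "w \<bullet> e < 0" "w' \<bullet> e < 0"
      using outer_normal_open_strict[OF assms(1) _ z] w w'
      by (auto simp: e_def inner_diff_right)
    \<comment> \<open>\<open>f\<close> is a positive combination of \<open>d\<close> and the inward direction \<open>e\<close>, chosen to lie on the
      second line.\<close>
    define f where "f = (w' \<bullet> d) *\<^sub>R e - (w' \<bullet> e) *\<^sub>R d"
    have "w' \<bullet> f = 0" by (simp add: f_def inner_diff_right)
    then have "p + f \<in> {y. w \<bullet> y = w \<bullet> p}"
      unfolding same by (simp add: inner_right_distrib)
    then have "w \<bullet> f = 0" by (simp add: inner_right_distrib)
    moreover have "(w' \<bullet> d) * (w \<bullet> e) \<le> 0"
      using d' e by (simp add: mult_nonneg_nonpos)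
    moreover have "(w' \<bullet> e) * (w \<bullet> d) > 0"
      using d e by (simp add: mult_neg_neg)
    ultimately show False by (simp add: f_def inner_diff_right)
  qed
  moreover have "p \<in> closure C"
    using assms(3) by (auto simp: C2_at_def frontier_def)
  ultimately show ?thesis
    using w unfolding smooth_point_def by blast
qed

text \<open>If an open ray from \<open>p\<close> missed \<open>C\<close>, a line separating it from \<open>C\<close> would have to pass
  through \<open>p\<close>, and its normal would be an outer normal on which \<open>d\<close> is nonnegative. So the
  ray meets \<open>C\<close>, and convexity fills in the part of it between \<open>p\<close> and the meeting point.\<close>

lemma smooth_point_ray_inside:
  assumes "open C" "convex C" "C \<noteq> {}" and sm: "smooth_point C p w" and d: "w \<bullet> d < 0"
  shows "eventually (\<lambda>t. p + t *\<^sub>R d \<in> C) (at_right 0)"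
proof -
  have p: "p \<in> closure C" using sm by (simp add: smooth_point_def)
  have "\<exists>t>0. p + t *\<^sub>R d \<in> C"
  proof (rule ccontr)
    assume no: "\<not> (\<exists>t>0. p + t *\<^sub>R d \<in> C)"
    define R where "R = (\<lambda>t. p + t *\<^sub>R d) ` {0<..}"
    have "R = (+) p ` (\<lambda>t. t *\<^sub>R d) ` {0<..}"
      by (simp add: R_def image_image)
    then have "convex R"
      by (metis convex_translation convex_real_interval(3) convex_scaled)
    moreover have "R \<noteq> {}" "C \<inter> R = {}" using no by (auto simp: R_def)
    ultimately obtain w' b where w': "w' \<noteq> 0" "\<forall>x\<in>C. w' \<bullet> x \<le> b" "\<forall>x\<in>R. w' \<bullet> x \<ge> b"
      using separating_hyperplane_sets[of C R] assms by metis
    have ray: "b \<le> w' \<bullet> p + t * (w' \<bullet> d)" if "t > 0" for t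
      using w'(3) that by (auto simp: R_def inner_right_distrib)
    have "C \<subseteq> {x. w' \<bullet> x \<le> b}" using w'(2) by blast
    then have "closure C \<subseteq> {x. w' \<bullet> x \<le> b}"
      by (rule closure_minimal) (rule closed_halfspace_le)
    then have pb: "w' \<bullet> p \<le> b" using p by blast
    have "((\<lambda>t. w' \<bullet> p + t * (w' \<bullet> d)) \<longlongrightarrow> w' \<bullet> p + 0 * (w' \<bullet> d)) (at_right 0)"
      by (intro tendsto_intros)
    moreover have "eventually (\<lambda>t. b \<le> w' \<bullet> p + t * (w' \<bullet> d)) (at_right 0)"
      using ray by (auto simp: eventually_at_right_field intro: exI[of _ 1])
    ultimately have "b \<le> w' \<bullet> p + 0 * (w' \<bullet> d)"
      by (rule tendsto_lowerbound) simp
    then have "outer_normal C p w'"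
      using w' by (fastforce simp: outer_normal_def)
    then have "w' \<bullet> d < 0" using sm d by (auto simp: smooth_point_def)
    with ray[of 1] pb show False by simp
  qed
  then obtain t0 where t0: "t0 > 0" "p + t0 *\<^sub>R d \<in> C" by blast
  have "p + t *\<^sub>R d \<in> C" if "0 < t" "t < t0" for t
  proof -
    have "p - (t / t0) *\<^sub>R (p - (p + t0 *\<^sub>R d)) \<in> interior C"
      using assms t0 that p by (intro mem_interior_closure_convex_shrink) (auto simp: interior_open)
    then show ?thesis using t0 assms by (simp add: interior_open)
  qed
  then show ?thesis using t0 by (auto simp: eventually_at_right_field)
qed

lemma outer_normal_ray_outside:
  assumes "outer_normal C p w" "w \<bullet> d > 0" "t > 0"
  shows "p + t *\<^sub>R d \<notin> closure C"
proof -
  have "C \<subseteq> {x. w \<bullet> x \<le> w \<bullet> p}" using assms by (auto simp: outer_normal_def)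
  then have "closure C \<subseteq> {x. w \<bullet> x \<le> w \<bullet> p}"
    by (rule closure_minimal) (rule closed_halfspace_le)
  moreover have "w \<bullet> (p + t *\<^sub>R d) > w \<bullet> p"
    using assms by (simp add: inner_right_distrib)
  ultimately show ?thesis by force
qed

section \<open>The construction\<close>

lemma num_k_sets_le_max_k_sets:
  assumes "finite S" "card S = n"
  shows "num_k_sets F k S \<le> max_k_sets F k n"
proof -
  have "num_k_sets F k S \<le> 2 ^ n" if "finite S" "card S = n" for S
  proof -
    have "num_k_sets F k S \<le> card (Pow S)"
      unfolding num_k_sets_def using that by (intro card_mono) (auto simp: is_k_set_def)
    then show ?thesis using that by (simp add: card_Pow)
  qed
  then have "{num_k_sets F k S | S. finite S \<and> card S = n} \<subseteq> {..2 ^ n}" by auto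
  then have "finite {num_k_sets F k S | S. finite S \<and> card S = n}"
    using finite_subset by blast
  then show ?thesis
    unfolding max_k_sets_def using assms by (intro Max_ge) auto
qed

lemma card_half_integers_below:
  assumes "y \<in> \<int>" "\<bar>y\<bar> \<le> real M"
  shows "real (card {m \<in> {- int M..<int M}. real_of_int m + 1/2 < y}) = real M + y"
proof -
  obtain i where i: "y = of_int i" using assms Ints_cases by blast
  have "\<bar>real_of_int i\<bar> \<le> real M" using assms(2) i by simp
  then have bound: "\<bar>i\<bar> \<le> int M" by linarith
  have "real_of_int m + 1/2 < y \<longleftrightarrow> m < i" for m unfolding i by linarith
  then have "{m \<in> {- int M..<int M}. real_of_int m + 1/2 < y} = {m \<in> {- int M..<int M}. m < i}"
    by (simp only:)
  also have "\<dots> = {- int M..<i}" using bound by fastforce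
  finally show ?thesis using bound by (simp add: i)
qed

text \<open>The construction works for any finite set \<open>W\<close> of normals that sum to zero: the row at the
  normal \<open>w\<close> contributes \<open>M + w \<bullet> y\<close> points to the translate by \<open>\<delta> y\<close>, so the
  contributions always add up to \<open>card W * M\<close>. The condition on \<open>a\<close> with respect to the other
  normals ensures that different normals belong to different boundary points.\<close>

lemma many_k_sets_from_balanced_normals:
  fixes C W Y :: "(real^2) set"
  assumes C: "open C" "convex C" "bounded C" "C \<noteq> {}"
    and W: "finite W" "\<Sum>W = 0"
    and smooth: "\<And>w. w \<in> W \<Longrightarrow> \<exists>p. smooth_point C p w"
    and dual: "\<And>w. w \<in> W \<Longrightarrow> \<exists>a. w \<bullet> a = 1 \<and> (\<forall>w'\<in>W - {w}. w' \<bullet> a \<le> 0)"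
    and Y: "finite Y" "\<And>y w. y \<in> Y \<Longrightarrow> w \<in> W \<Longrightarrow> w \<bullet> y \<in> \<int> \<and> \<bar>w \<bullet> y\<bar> \<le> real M"
    and sep: "\<And>y y'. y \<in> Y \<Longrightarrow> y' \<in> Y \<Longrightarrow> y \<noteq> y' \<Longrightarrow> \<exists>w\<in>W. w \<bullet> y \<noteq> w \<bullet> y'"
    and k: "card W * M \<le> k" "k + card W * M \<le> n"
  shows "\<exists>S. finite S \<and> card S = n \<and> card Y \<le> num_k_sets (translates C) k S"
proof -
  obtain p where p: "\<And>w. w \<in> W \<Longrightarrow> smooth_point C (p w) w" using smooth by metis
  obtain a where a: "\<And>w. w \<in> W \<Longrightarrow> w \<bullet> a w = 1"
      "\<And>w w'. w \<in> W \<Longrightarrow> w' \<in> W \<Longrightarrow> w' \<noteq> w \<Longrightarrow> w' \<bullet> a w \<le> 0"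
    using dual by (metis DiffI singletonD)
  obtain z r where r: "r > 0" "ball z (2 * r) \<subseteq> C"
  proof -
    obtain z where "z \<in> C" using C by blast
    then obtain e where "e > 0" "ball z e \<subseteq> C" using C(1) openE by blast
    then show thesis using that[of "e / 2" z] by simp
  qed
  have "bounded (closure C)" using C(3) by (rule bounded_closure)
  then obtain R where R: "\<And>x. x \<in> closure C \<Longrightarrow> norm x \<le> R" by (auto simp: bounded_iff)
  define J where "J = {- int M..<int M}"
  define h :: "int \<Rightarrow> real" where "h m = of_int m + 1/2" for m
  define s where "s \<delta> = (\<lambda>(w, m). p w + \<delta> *\<^sub>R (h m *\<^sub>R a w))" for \<delta>
  have [simp]: "finite J" by (simp add: J_def)
  \<comment> \<open>A common smooth point would force \<open>w' \<bullet> (- a w) < 0\<close>, so the rows have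
    distinct centres.\<close>
  have p_inj: "p w \<noteq> p w'" if "w \<in> W" "w' \<in> W" "w \<noteq> w'" for w w'
  proof
    assume eq: "p w = p w'"
    have "w \<bullet> (- a w) < 0" using a(1)[OF that(1)] by simp
    then have "w' \<bullet> (- a w) < 0"
      using p[OF that(1)] p[OF that(2)] eq unfolding smooth_point_def by metis
    with a(2)[of w w'] that show False by simp
  qed
  \<comment> \<open>Half-integers against integers: no row point comes to lie on the limiting half-plane's
    boundary line.\<close>
  have h_ne: "h m \<noteq> w \<bullet> y" if "y \<in> Y" "w \<in> W" for m y w
  proof
    assume eq: "h m = w \<bullet> y"
    have "w \<bullet> y \<in> \<int>" using Y(2) that by blast
    then obtain i where "w \<bullet> y = of_int i" using Ints_cases by blast
    then have "real_of_int (2 * m + 1) = of_int (2 * i)" using eq by (simp add: h_def)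
    then show False by presburger
  qed
  have shift: "s \<delta> (w, m) - \<delta> *\<^sub>R y = p w + \<delta> *\<^sub>R (h m *\<^sub>R a w - y)" for \<delta> w m y
    by (simp add: s_def scaleR_diff_right)
  have ev_in: "eventually (\<lambda>\<delta>. h m < w \<bullet> y \<longrightarrow> s \<delta> (w, m) - \<delta> *\<^sub>R y \<in> C) (at_right 0)"
    if "w \<in> W" for w m y
  proof (cases "h m < w \<bullet> y")
    case True
    then have "w \<bullet> (h m *\<^sub>R a w - y) < 0" using a(1)[OF that] by (simp add: inner_diff_right)
    then show ?thesis
      using smooth_point_ray_inside[OF C(1,2,4) p[OF that]] by (simp add: shift)
  qed simp
  have ev_inj: "eventually (\<lambda>\<delta>. s \<delta> i \<noteq> s \<delta> j) (at_right 0)"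
    if "i \<in> W \<times> J" "j \<in> W \<times> J" "i \<noteq> j" for i j
  proof -
    obtain w m w' m' where ij: "i = (w, m)" "j = (w', m')" by fastforce
    show ?thesis
    proof (cases "w = w'")
      case True
      then have "m \<noteq> m'" "a w \<noteq> 0" using that ij a(1)[of w] by auto
      then have "s \<delta> i \<noteq> s \<delta> j" if "\<delta> > 0" for \<delta>
        using that True by (simp add: ij s_def h_def)
      then show ?thesis by (auto simp: eventually_at_right_field intro: exI[of _ 1])
    next
      case False
      have "((\<lambda>\<delta>. s \<delta> i - s \<delta> j) \<longlongrightarrow>
          (p w + 0 *\<^sub>R (h m *\<^sub>R a w)) - (p w' + 0 *\<^sub>R (h m' *\<^sub>R a w'))) (at_right 0)"
        unfolding ij s_def prod.case by (intro tendsto_intros)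
      moreover have "p w - p w' \<noteq> 0" using p_inj False that ij by auto
      ultimately have "eventually (\<lambda>\<delta>. s \<delta> i - s \<delta> j \<noteq> 0) (at_right 0)"
        by (intro tendsto_imp_eventually_ne) auto
      then show ?thesis by simp
    qed
  qed
  have ev_small: "eventually (\<lambda>\<delta>. norm (\<delta> *\<^sub>R y) < r) (at_right 0)" for y
  proof -
    have "((\<lambda>\<delta>. norm (\<delta> *\<^sub>R y)) \<longlongrightarrow> norm (0 *\<^sub>R y)) (at_right 0)"
      by (intro tendsto_intros)
    then show ?thesis using r by (intro order_tendstoD(2)) auto
  qed
  have "eventually (\<lambda>\<delta>. \<forall>w\<in>W. \<forall>m\<in>J. \<forall>y\<in>Y.
      h m < w \<bullet> y \<longrightarrow> s \<delta> (w, m) - \<delta> *\<^sub>R y \<in> C) (at_right 0)"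
    using W(1) Y(1) ev_in by (simp add: eventually_ball_finite)
  moreover have "eventually (\<lambda>\<delta>. \<forall>i\<in>W \<times> J. \<forall>j\<in>W \<times> J. i \<noteq> j \<longrightarrow> s \<delta> i \<noteq> s \<delta> j)
      (at_right 0)"
  proof (intro eventually_ball_finite ballI)
    show "eventually (\<lambda>\<delta>. i \<noteq> j \<longrightarrow> s \<delta> i \<noteq> s \<delta> j) (at_right 0)"
      if "i \<in> W \<times> J" "j \<in> W \<times> J" for i j
      using ev_inj[OF that] by (cases "i = j") simp_all
  qed (use W in auto)
  moreover have "eventually (\<lambda>\<delta>. \<forall>y\<in>Y. norm (\<delta> *\<^sub>R y) < r) (at_right 0)"
    using Y(1) ev_small by (intro eventually_ball_finite ballI)
  moreover have "eventually (\<lambda>\<delta>. \<delta> > 0) (at_right (0::real))"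
    by (rule eventually_at_right_less)
  ultimately have "eventually (\<lambda>\<delta>.
      (\<forall>w\<in>W. \<forall>m\<in>J. \<forall>y\<in>Y. h m < w \<bullet> y \<longrightarrow> s \<delta> (w, m) - \<delta> *\<^sub>R y \<in> C) \<and>
      (\<forall>i\<in>W \<times> J. \<forall>j\<in>W \<times> J. i \<noteq> j \<longrightarrow> s \<delta> i \<noteq> s \<delta> j) \<and>
      (\<forall>y\<in>Y. norm (\<delta> *\<^sub>R y) < r) \<and> \<delta> > 0) (at_right 0)"
    by (intro eventually_conj)
  from eventually_happens'[OF trivial_limit_at_right_real this] obtain \<delta> where \<delta>_all:
      "(\<forall>w\<in>W. \<forall>m\<in>J. \<forall>y\<in>Y. h m < w \<bullet> y \<longrightarrow> s \<delta> (w, m) - \<delta> *\<^sub>R y \<in> C) \<and>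
      (\<forall>i\<in>W \<times> J. \<forall>j\<in>W \<times> J. i \<noteq> j \<longrightarrow> s \<delta> i \<noteq> s \<delta> j) \<and>
      (\<forall>y\<in>Y. norm (\<delta> *\<^sub>R y) < r) \<and> \<delta> > 0"
    by (elim exE)
  have \<delta>: "\<delta> > 0"
    and row_in: "\<And>w m y. w \<in> W \<Longrightarrow> m \<in> J \<Longrightarrow> y \<in> Y \<Longrightarrow> h m < w \<bullet> y \<Longrightarrow>
      s \<delta> (w, m) - \<delta> *\<^sub>R y \<in> C"
    and small: "\<And>y. y \<in> Y \<Longrightarrow> norm (\<delta> *\<^sub>R y) < r"
    using \<delta>_all by (simp_all del: norm_scaleR)
  have "\<forall>i\<in>W \<times> J. \<forall>j\<in>W \<times> J. i \<noteq> j \<longrightarrow> s \<delta> i \<noteq> s \<delta> j"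
    using \<delta>_all by (elim conjE)
  then have inj: "inj_on (s \<delta>) (W \<times> J)"
    unfolding inj_on_def by metis
  have row_out: "s \<delta> (w, m) - \<delta> *\<^sub>R y \<notin> closure C"
    if "w \<in> W" "y \<in> Y" "\<not> h m < w \<bullet> y" for w m y
  proof -
    have "w \<bullet> (h m *\<^sub>R a w - y) > 0"
      using h_ne[OF that(2,1), of m] that(3) a(1)[OF that(1)] by (simp add: inner_diff_right)
    moreover have "outer_normal C (p w) w" using p[OF that(1)] by (simp add: smooth_point_def)
    ultimately show ?thesis unfolding shift by (intro outer_normal_ray_outside \<delta>)
  qed
  define G where "G = s \<delta> ` (W \<times> J)"
  have finG: "finite G" using W by (simp add: G_def)
  have cardG: "card G = card W * (2 * M)"
    using inj by (simp add: G_def card_image card_cartesian_product J_def nat_mult_distrib)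
  \<comment> \<open>The translations are shorter than \<open>r\<close>, so points of \<open>ball z r\<close> lie in all the translates,
    and points of norm above \<open>R + r\<close> in none of their closures.\<close>
  have "infinite (ball z r - G)"
    using finG r uncountable_ball[of r z] countable_finite by (meson Diff_infinite_finite)
  then obtain A where A: "finite A" "card A = k - card W * M" "A \<subseteq> ball z r - G"
    using infinite_arbitrarily_large by blast
  have "infinite (- cball (0::real^2) (R + r) - G)"
  proof -
    have "\<not> bounded (- cball (0::real^2) (R + r))"
      by (simp add: bounded_cball cobounded_imp_unbounded)
    then have "infinite (- cball (0::real^2) (R + r))" using finite_imp_bounded by blast
    then show ?thesis using finG by (simp add: Diff_infinite_finite)
  qed
  then obtain B where B: "finite B" "card B = n - k - card W * M"
      "B \<subseteq> - cball 0 (R + r) - G"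
    using infinite_arbitrarily_large by blast
  have A_in: "x - \<delta> *\<^sub>R y \<in> C" if "x \<in> A" "y \<in> Y" for x y
  proof -
    have "dist z x < r" using A that by auto
    moreover have "dist x (x - \<delta> *\<^sub>R y) < r" using small that by (simp add: dist_norm)
    ultimately have "x - \<delta> *\<^sub>R y \<in> ball z (2 * r)"
      using dist_triangle[of z "x - \<delta> *\<^sub>R y" x] by simp
    then show ?thesis using r by blast
  qed
  have B_out: "x - \<delta> *\<^sub>R y \<notin> closure C" if "x \<in> B" "y \<in> Y" for x y
  proof
    assume "x - \<delta> *\<^sub>R y \<in> closure C"
    then have "norm (x - \<delta> *\<^sub>R y) \<le> R" by (rule R)
    moreover have "norm x > R + r" using B that by auto
    ultimately show False using small[OF that(2)] norm_triangle_sub[of x "\<delta> *\<^sub>R y"] by simp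
  qed
  have AB: "A \<inter> B = {}"
  proof -
    have "norm x \<le> R" if "x \<in> A" for x
    proof -
      have "x \<in> ball z (2 * r)" using A that r by auto
      then show ?thesis using r R closure_subset by blast
    qed
    then show ?thesis using B r by fastforce
  qed
  define S where "S = G \<union> (A \<union> B)"
  have "card S = card G + (card A + card B)"
    unfolding S_def using finG A B AB by (subst card_Un_disjoint; (subst card_Un_disjoint)?) auto
  then have cardS: "card S = n" using k by (simp add: cardG A B algebra_simps)
  have finS: "finite S" using finG A B by (simp add: S_def)
  define Q where "Q y = (+) (\<delta> *\<^sub>R y) ` C" for y
  have mem_Q: "x \<in> Q y \<longleftrightarrow> x - \<delta> *\<^sub>R y \<in> C" for x y
    by (force simp: Q_def)
  have fr_Q: "x - \<delta> *\<^sub>R y \<in> closure C - C" if "x \<in> frontier (Q y)" for x y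
  proof -
    have "frontier C = closure C - C" using C(1) by (simp add: frontier_def interior_open)
    then have "frontier (Q y) = (+) (\<delta> *\<^sub>R y) ` (closure C - C)"
      by (simp only: Q_def frontier_translation)
    then show ?thesis using that by auto
  qed
  define T where "T y = S \<inter> Q y" for y
  have row_iff: "s \<delta> (w, m) \<in> Q y \<longleftrightarrow> h m < w \<bullet> y" if "w \<in> W" "m \<in> J" "y \<in> Y" for w m y
    using row_in[OF that] row_out[OF that(1,3)] closure_subset mem_Q by blast
  have T_eq: "T y = s \<delta> ` (SIGMA w:W. {m\<in>J. h m < w \<bullet> y}) \<union> A" if "y \<in> Y" for y
    using that row_iff A_in B_out closure_subset[of C]
    unfolding T_def S_def G_def by (auto simp: mem_Q)
  have cardT: "card (T y) = k" if "y \<in> Y" for y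
  proof -
    let ?I = "SIGMA w:W. {m\<in>J. h m < w \<bullet> y}"
    have I: "?I \<subseteq> W \<times> J" by auto
    have "real (card ?I) = (\<Sum>w\<in>W. real (card {m\<in>J. h m < w \<bullet> y}))"
      using W by (simp add: card_SigmaI)
    also have "\<dots> = (\<Sum>w\<in>W. real M + w \<bullet> y)"
      unfolding J_def h_def
      using Y(2)[OF that] by (intro sum.cong refl card_half_integers_below) auto
    also have "\<dots> = real (card W * M)"
      using W(2) by (simp add: sum.distrib flip: inner_sum_left)
    finally have "card ?I = card W * M" by linarith
    moreover have "card (s \<delta> ` ?I) = card ?I"
      using inj I by (intro card_image) (rule inj_on_subset)
    moreover have "s \<delta> ` ?I \<inter> A = {}" using A I unfolding G_def by blast
    ultimately show ?thesis
      using that k(1) A W finite_subset[OF I] by (simp add: T_eq card_Un_disjoint)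
  qed
  have fr: "S \<inter> frontier (Q y) = {}" if y: "y \<in> Y" for y
  proof -
    have "x - \<delta> *\<^sub>R y \<notin> closure C - C" if x: "x \<in> S" for x
    proof -
      consider w m where "w \<in> W" "m \<in> J" "x = s \<delta> (w, m)" | "x \<in> A" | "x \<in> B"
        using x unfolding S_def G_def by blast
      then show ?thesis
      proof cases
        case 1 then show ?thesis using row_in row_out y by (cases "h m < w \<bullet> y") auto
      next
        case 2 then show ?thesis using A_in y by blast
      next
        case 3 then show ?thesis using B_out y by blast
      qed
    qed
    then show ?thesis using fr_Q by blast
  qed
  \<comment> \<open>The row of \<open>w\<close> separates them: its point at height \<open>w \<bullet> y + 1/2\<close> lies in the
    translate of \<open>y'\<close> only.\<close>
  have distinct: "T y \<noteq> T y'" if yy: "y \<in> Y" "y' \<in> Y" and w: "w \<in> W" and less: "w \<bullet> y < w \<bullet> y'"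
    for y y' w
  proof -
    obtain i i' where i: "w \<bullet> y = of_int i" "w \<bullet> y' = of_int i'"
      using Y(2) yy w by (meson Ints_cases)
    have "\<bar>of_int i\<bar> \<le> real M" "\<bar>of_int i'\<bar> \<le> real M" using Y(2) yy w i by metis+
    then have "\<bar>i\<bar> \<le> int M" "\<bar>i'\<bar> \<le> int M" by linarith+
    moreover have "i < i'" using less i by simp
    ultimately have "- int M \<le> i \<and> i < int M" by linarith
    then have "i \<in> J" by (simp add: J_def)
    moreover have "h i < w \<bullet> y'" "\<not> h i < w \<bullet> y" using less by (auto simp: i h_def)
    ultimately have "s \<delta> (w, i) \<in> T y'" "s \<delta> (w, i) \<notin> T y"
      using row_iff yy w by (auto simp: T_def S_def G_def)
    then show ?thesis by blast
  qed
  have "inj_on T Y"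
    using sep distinct by (metis inj_onI linorder_neqE_linordered_idom)
  then have "card Y = card (T ` Y)" by (simp add: card_image)
  also have "\<dots> \<le> num_k_sets (translates C) k S"
    unfolding num_k_sets_def
  proof (rule card_mono)
    have "{X. is_k_set (translates C) k S X} \<subseteq> Pow S" by (auto simp: is_k_set_def)
    then show "finite {X. is_k_set (translates C) k S X}" using finS finite_subset by blast
    have Q_trans: "Q y \<in> translates C" for y by (auto simp: Q_def translates_def)
    have "is_k_set (translates C) k S (T y)" if "y \<in> Y" for y
      unfolding is_k_set_def using cardT[OF that] fr[OF that] Q_trans[of y] T_def by blast
    then show "T ` Y \<subseteq> {X. is_k_set (translates C) k S X}"
      by blast
  qed
  finally show ?thesis using finS cardS by blast
qed

section \<open>Two pairs of opposite normals\<close>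

text \<open>The component of \<open>u\<close> orthogonal to \<open>v\<close>, rescaled; it is nonzero by the equality case of
  the Cauchy-Schwarz inequality.\<close>

lemma unit_pair_dual_vector:
  fixes u v :: "'a::euclidean_space"
  assumes "norm u = 1" "norm v = 1" "u \<noteq> v" "u \<noteq> - v"
  shows "\<exists>a. u \<bullet> a = 1 \<and> v \<bullet> a = 0"
proof -
  have "\<bar>u \<bullet> v\<bar> \<noteq> 1"
    using assms norm_cauchy_schwarz_abs_eq[of u v] by auto
  then have ne: "1 - (u \<bullet> v)\<^sup>2 \<noteq> 0"
    by (simp add: power2_eq_1_iff abs_if split: if_splits)
  have "u \<bullet> u = 1" "v \<bullet> v = 1" using assms by (simp_all add: dot_square_norm)
  then have "u \<bullet> ((1 / (1 - (u \<bullet> v)\<^sup>2)) *\<^sub>R (u - (u \<bullet> v) *\<^sub>R v)) = 1"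
    "v \<bullet> ((1 / (1 - (u \<bullet> v)\<^sup>2)) *\<^sub>R (u - (u \<bullet> v) *\<^sub>R v)) = 0"
    using ne by (simp_all add: inner_diff_right inner_commute power2_eq_square)
  then show ?thesis by blast
qed

text \<open>For the dual basis \<open>a\<close>, \<open>b\<close> of \<open>u\<close>, \<open>v\<close>, the grid points \<open>i a + j b\<close> with \<open>\<bar>i\<bar>, \<bar>j\<bar> \<le> M\<close>
  serve as translation vectors.\<close>

lemma quadratically_many_k_sets:
  fixes C :: "(real^2) set"
  assumes C: "open C" "convex C" "bounded C" "C \<noteq> {}"
    and uv: "norm u = 1" "norm v = 1" "u \<noteq> v" "u \<noteq> - v"
    and smooth: "\<And>w. w \<in> {u, v, -u, -v} \<Longrightarrow> \<exists>p. smooth_point C p w"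
    and k: "4 * M \<le> k" "k + 4 * M \<le> n"
  shows "(2 * M + 1)\<^sup>2 \<le> max_k_sets (translates C) k n"
proof -
  obtain a where a: "u \<bullet> a = 1" "v \<bullet> a = 0"
    using unit_pair_dual_vector uv by blast
  obtain b where b: "v \<bullet> b = 1" "u \<bullet> b = 0"
    using unit_pair_dual_vector[of v u] uv by (metis minus_minus)
  have nz: "u \<noteq> 0" "v \<noteq> 0" using uv by auto
  have neg: "x \<noteq> - x" if "x \<noteq> 0" for x :: "real^2"
  proof
    assume "x = - x"
    then have "x \<bullet> x = - (x \<bullet> x)" by (metis inner_minus_left)
    then show False using that by simp
  qed
  have ne: "u \<noteq> - u" "v \<noteq> - v" "v \<noteq> - u" "- u \<noteq> - v"
    using neg nz uv by (auto simp: equation_minus_iff)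
  define W where "W = {u, v, -u, -v}"
  have W: "card W = 4" "\<Sum>W = 0"
    using ne uv by (auto simp: W_def)
  define I where "I = {- int M..int M}"
  define g where "g = (\<lambda>(i, j). of_int i *\<^sub>R a + of_int j *\<^sub>R b)"
  have g: "u \<bullet> g (i, j) = of_int i" "v \<bullet> g (i, j) = of_int j" for i j
    using a b by (simp_all add: g_def inner_right_distrib)
  have "inj_on g (I \<times> I)"
    by (rule inj_onI) (metis g of_int_eq_iff surj_pair)
  moreover have "card I = 2 * M + 1" by (simp add: I_def nat_add_distrib nat_mult_distrib)
  ultimately have card: "card (g ` (I \<times> I)) = (2 * M + 1)\<^sup>2"
    by (simp add: card_image card_cartesian_product power2_eq_square)
  have "\<exists>S. finite S \<and> card S = n \<and> card (g ` (I \<times> I)) \<le> num_k_sets (translates C) k S"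
  proof (rule many_k_sets_from_balanced_normals[OF C _ W(2)])
    show "\<exists>a. w \<bullet> a = 1 \<and> (\<forall>w'\<in>W - {w}. w' \<bullet> a \<le> 0)" if "w \<in> W" for w
    proof -
      consider "w = u" | "w = v" | "w = -u" | "w = -v" using \<open>w \<in> W\<close> by (auto simp: W_def)
      then show ?thesis
      proof cases
        case 1 then show ?thesis using a by (intro exI[of _ a]) (auto simp: W_def)
      next
        case 2 then show ?thesis using b by (intro exI[of _ b]) (auto simp: W_def)
      next
        case 3 then show ?thesis using a by (intro exI[of _ "-a"]) (auto simp: W_def)
      next
        case 4 then show ?thesis using b by (intro exI[of _ "-b"]) (auto simp: W_def)
      qed
    qed
    show "w \<bullet> y \<in> \<int> \<and> \<bar>w \<bullet> y\<bar> \<le> real M" if "y \<in> g ` (I \<times> I)" "w \<in> W" for y w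
      using that by (auto simp: W_def g I_def abs_le_iff)
    show "\<exists>w\<in>W. w \<bullet> y \<noteq> w \<bullet> y'"
      if "y \<in> g ` (I \<times> I)" "y' \<in> g ` (I \<times> I)" "y \<noteq> y'" for y y'
      using that by (auto simp: W_def g)
  qed (use smooth k W(1) in \<open>auto simp: W_def I_def\<close>)
  then show ?thesis
    using num_k_sets_le_max_k_sets card by (metis le_trans)
qed

theorem theorem4p13:
  fixes C :: "(real^2) set" and c c' :: real
  assumes "\<exists>K. convex_body K \<and> C = interior K"
    and "\<exists>u v p1 p2 p3 p4 :: real^2.
           norm u = 1 \<and> norm v = 1 \<and> u \<noteq> v \<and> independent {u, v} \<and>
           {p1, p2, p3, p4} \<subseteq> frontier C \<and>
           C2_near C p1 \<and> C2_near C p2 \<and> C2_near C p3 \<and> C2_near C p4 \<and>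
           outer_normal C p1 u \<and> outer_normal C p2 v \<and>
           outer_normal C p3 (- u) \<and> outer_normal C p4 (- v)"
    and "0 < c" and "c < c'" and "c' < 1"
  shows "\<exists>\<alpha>>0. \<exists>N. \<forall>n\<ge>N. \<forall>k::nat.
           c * real n \<le> real k \<and> real k \<le> c' * real n \<longrightarrow>
           real (max_k_sets (translates C) k n) \<ge> \<alpha> * (real n)\<^sup>2"
proof -
  obtain K where K: "convex_body K" "C = interior K" using assms(1) by blast
  have "bounded K" using K by (auto simp: convex_body_def compact_imp_bounded)
  then have C: "open C" "convex C" "bounded C" "C \<noteq> {}"
    using K bounded_subset[OF _ interior_subset] by (auto simp: convex_body_def)
  obtain u v p1 p2 p3 p4 where uv: "norm u = 1" "norm v = 1" "u \<noteq> v" "independent {u, v}"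
    and fr: "{p1, p2, p3, p4} \<subseteq> frontier C"
    and C2: "C2_near C p1" "C2_near C p2" "C2_near C p3" "C2_near C p4"
    and nrm: "outer_normal C p1 u" "outer_normal C p2 v"
      "outer_normal C p3 (- u)" "outer_normal C p4 (- v)"
    using assms(2) by metis
  have "u \<noteq> - v"
  proof
    assume "u = - v"
    then have "u \<in> span ({u, v} - {u})"
      using uv by (simp add: span_base span_neg)
    then show False using uv by (auto simp: dependent_def)
  qed
  have "C2_at C q" if "q \<in> {p1, p2, p3, p4}" for q
    using C2 fr that unfolding C2_near_def by blast
  then have smooth: "\<exists>p. smooth_point C p w" if "w \<in> {u, v, -u, -v}" for w
    using that nrm C2_at_imp_smooth_point[OF C(1,4)] by fastforce
  \<comment> \<open>Both \<open>k\<close> and \<open>n - k\<close> are at least \<open>\<mu> n\<close>, which leaves room for \<open>4 M\<close> points when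
    \<open>M\<close> is about \<open>\<mu> n / 4\<close>.\<close>
  define \<mu> where "\<mu> = min c (1 - c')"
  have \<mu>: "\<mu> > 0" "\<mu> \<le> c" "\<mu> \<le> 1 - c'" using assms by (auto simp: \<mu>_def)
  have "(\<mu> / 4)\<^sup>2 * (real n)\<^sup>2 \<le> real (max_k_sets (translates C) k n)"
    if n: "n \<ge> nat \<lceil>4 / \<mu>\<rceil>" and k: "c * real n \<le> real k" "real k \<le> c' * real n" for n k
  proof -
    define M where "M = nat \<lfloor>\<mu> * real n / 4\<rfloor>"
    have M: "real M \<le> \<mu> * real n / 4" "\<mu> * real n / 4 < real M + 1"
      using \<mu> of_nat_floor[of "\<mu> * real n / 4"] floor_correct[of "\<mu> * real n / 4"]
      by (simp_all add: M_def)
    have "\<mu> * real n \<le> c * real n" "\<mu> * real n \<le> (1 - c') * real n"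
      using \<mu> by (intro mult_right_mono; simp)+
    then have "4 * M \<le> k" "k + 4 * M \<le> n" using M k by (auto simp: algebra_simps)
    then have "(2 * M + 1)\<^sup>2 \<le> max_k_sets (translates C) k n"
      using quadratically_many_k_sets[OF C uv(1-3) \<open>u \<noteq> - v\<close> smooth] by blast
    then have le: "(2 * real M + 1)\<^sup>2 \<le> real (max_k_sets (translates C) k n)"
      by (metis (mono_tags) of_nat_1 of_nat_add of_nat_le_iff of_nat_mult of_nat_numeral of_nat_power)
    have "4 / \<mu> \<le> real n" using n by linarith
    then have "\<mu> * real n \<ge> 4" using \<mu> by (simp add: field_simps)
    then have "\<mu> / 4 * real n \<le> 2 * real M + 1" using M by simp
    then have "(\<mu> / 4 * real n)\<^sup>2 \<le> (2 * real M + 1)\<^sup>2"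
      using \<mu> by (intro power_mono) auto
    with le show ?thesis by (simp add: power_mult_distrib power_divide)
  qed
  then show ?thesis
    using \<mu>(1)
    by (intro exI[of _ "(\<mu> / 4)\<^sup>2"] conjI exI[of _ "nat \<lceil>4 / \<mu>\<rceil>"] allI impI) auto
qed

end
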